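(* Let $B$, $C$, $D$ be binary variables with values $b,\neg b$; $c,\neg c$; $d,\neg d$, where $B$ and $C$ are the two (independent) parents of $D$ (the link $B\&C\rightarrow D$), quantified by fixed conditional beliefs of the form $bel(z\mid x,y)$ and combined by Dempster's rule. Then for all $x\in\{b,\neg b\}$, $y\in\{c,\neg c\}$, $z\in\{d,\neg d\}$, the relation between $bel(z)$ and $bel(x)$ is determined by $$\left[\frac{\partial bel(z)}{\partial bel(x)}\right]=\big[bel(z\mid x,y)-bel(z\mid x\cup\neg x,y)\big]\oplus\big[bel(z\mid x,\neg y)-bel(z\mid x\cup\neg x,\neg y)\big]\oplus\big[bel(z\mid x,y\cup\neg y)-bel(z\mid x\cup\neg x,y\cup\neg y)\big].$$
   Context: Convention: $\neg\neg v=v$ for each value $v$; $x\cup\neg x$ denotes the whole frame of the variable, and $bel(b)$ abbreviates $bel(\{b\})$, etc. The conditional beliefs $bel(z\mid \beta,\gamma)\in[0,1]$, for $z\in\{d,\neg d\}$, $\beta\in\{b,\neg b,b\cup\neg b\}$, $\gamma\in\{c,\neg c,c\cup\neg c\}$, are constants. For each parent, the beliefs in its two values are nonnegative with sum at most $1$, and the corresponding mass function is $m(v)=bel(v)$, $m(\neg v)=bel(\neg v)$, $m(v\cup\neg v)=1-bel(v)-bel(\neg v)$ ($v=b$ or $v=c$). The beliefs at $D$ are given by Dempster's rule as $$bel(z)=\sum_{\beta\in\{b,\neg b,b\cup\neg b\}}\ \sum_{\gamma\in\{c,\neg c,c\cup\neg c\}}m(\beta)\,m(\gamma)\,bel(z\mid\beta,\gamma).$$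 The partial derivative $\partial bel(z)/\partial bel(x)$ is taken with $bel(\neg x)$ and the beliefs of the other parent held fixed. Qualitative values: for a real number $r$, $[r]$ denotes $[+]$ if $r>0$, $[0]$ if $r=0$, $[-]$ if $r<0$. There is also a value $[?]$, meaning "any of $[+]$, $[0]$, $[-]$" (so an equation with $[?]$ on the right imposes no restriction). Qualitative addition $\oplus$ is commutative and given by: $[+]\oplus[+]=[+]$, $[+]\oplus[0]=[+]$, $[+]\oplus[-]=[?]$, $[0]\oplus[0]=[0]$, $[0]\oplus[-]=[-]$, $[-]\oplus[-]=[-]$, and $[?]\oplus q=[?]$ for every $q$.
   Formalization: Added assumption: if some difference bel(z|x,γ) − bel(z|x∪¬x,γ) is nonzero, then some γ with nonzero difference has m(γ) > 0; without it the equation fails, e.g. when bel(c)=bel(¬c)=0, bel(d|b,c)=1 and all other conditional beliefs are 0. *)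

theory Defs
  imports "HOL-Analysis.Analysis"
begin

text \<open>
  A value of a binary variable is a Boolean: the variable's positive value \<open>v\<close> is \<open>True\<close>, its
  negation is \<open>False\<close>, so the negation of values is the HOL negation and is involutive.  A set of
  values is a \<open>bool set\<close>; the whole frame of a variable is \<open>UNIV\<close>.  The three nonempty sets
  are the only candidates for carrying mass.
\<close>

definition focal_sets :: "bool set set" where
  "focal_sets = {{True}, {False}, UNIV}"

text \<open>A parent is described by the beliefs in its two values.\<close>

definition belief_pair :: "(bool \<Rightarrow> real) \<Rightarrow> bool" where
  "belief_pair bel \<longleftrightarrow> 0 \<le> bel True \<and> 0 \<le> bel False \<and> bel True + bel False \<le> 1"

definition mass :: "(bool \<Rightarrow> real) \<Rightarrow> bool set \<Rightarrow> real" where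
  "mass bel S =
     (if S = {True} then bel True
      else if S = {False} then bel False
      else if S = UNIV then 1 - bel True - bel False
      else 0)"

text \<open>
  \<open>cbel z \<beta> \<gamma>\<close> is the conditional belief \<open>bel(z | \<beta>, \<gamma>)\<close>, and \<open>belD cbel belB belC z\<close> is the
  belief in \<open>z\<close> that Dempster's rule yields at the child.
\<close>

definition belD ::
    "(bool \<Rightarrow> bool set \<Rightarrow> bool set \<Rightarrow> real) \<Rightarrow> (bool \<Rightarrow> real) \<Rightarrow> (bool \<Rightarrow> real) \<Rightarrow> bool \<Rightarrow> real" where
  "belD cbel belB belC z =
     (\<Sum>\<beta>\<in>focal_sets. \<Sum>\<gamma>\<in>focal_sets. mass belB \<beta> * mass belC \<gamma> * cbel z \<beta> \<gamma>)"

datatype qval = QPos | QZero | QNeg | QAny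

definition qsign :: "real \<Rightarrow> qval" where
  "qsign r = (if r > 0 then QPos else if r = 0 then QZero else QNeg)"

fun qadd :: "qval \<Rightarrow> qval \<Rightarrow> qval" (infixl "\<oplus>\<^sub>q" 65) where
  "QAny \<oplus>\<^sub>q q = QAny"
| "q \<oplus>\<^sub>q QAny = QAny"
| "QZero \<oplus>\<^sub>q q = q"
| "q \<oplus>\<^sub>q QZero = q"
| "QPos \<oplus>\<^sub>q QPos = QPos"
| "QNeg \<oplus>\<^sub>q QNeg = QNeg"
| "QPos \<oplus>\<^sub>q QNeg = QAny"
| "QNeg \<oplus>\<^sub>q QPos = QAny"

text \<open>
  A qualitative equation whose right-hand side is \<open>QAny\<close> (written [?]) imposes no restriction, so
  it is not plain equality of qualitative values.
\<close>

definition qeq :: "qval \<Rightarrow> qval \<Rightarrow> bool" (infix "=\<^sub>q" 50) where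
  "p =\<^sub>q q \<longleftrightarrow> q = QAny \<or> p = q"

end

theory Submission
  imports Defs
begin

text \<open>
  Raising \<open>bel(x)\<close> with \<open>bel(\<not> x)\<close> fixed moves mass from \<open>x \<union> \<not> x\<close> to \<open>x\<close>, so \<open>bel(z)\<close> is affine in \<open>bel(x)\<close>
  and its slope is the average of the differences \<open>bel(z | x, \<gamma>) - bel(z | x \<union> \<not> x, \<gamma>)\<close> weighted by
  \<open>m(\<gamma>) \<ge> 0\<close>.  If the qualitative sum is not [?], these differences do not have opposite signs, and
  the average has their common sign as soon as a nonzero one carries positive weight.
\<close>

lemma focal_sets_eq: "focal_sets = {{v}, {\<not> v}, UNIV}"
  by (cases v) (auto simp: focal_sets_def)

lemma singleton_neq_UNIV_bool: "{v :: bool} \<noteq> UNIV"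
  by (metis UNIV_I singletonD)

text \<open>Splitting around an arbitrary \<open>v\<close> lets \<open>x\<close> and
  \<open>y\<close> stay symbolic later, with no case distinction on them.\<close>

lemma sum_focal_sets: "sum f focal_sets = f {v} + f {\<not> v} + f UNIV"
  by (simp add: focal_sets_eq[of v] singleton_neq_UNIV_bool add.assoc)

lemma mass_singleton: "mass bel {v} = bel v"
  by (cases v) (auto simp: mass_def)

lemma mass_UNIV: "mass bel UNIV = 1 - bel v - bel (\<not> v)"
  using singleton_neq_UNIV_bool by (cases v) (auto simp: mass_def dest: sym)

lemma mass_nonneg:
  assumes "belief_pair bel"
  shows "mass bel S \<ge> 0"
  using assms by (auto simp: mass_def belief_pair_def)

text \<open>Only the masses of \<open>{x}\<close> and of \<open>UNIV\<close> at the parent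
  \<open>B\<close> depend on \<open>t\<close>, namely \<open>t\<close> and
  \<open>1 - t - belB (\<not> x)\<close>; collecting \<open>t\<close> gives the slope.\<close>

lemma belD_fun_upd:
  "belD cbel (belB(x := t)) belC z =
     t * (\<Sum>\<gamma>\<in>focal_sets. mass belC \<gamma> * (cbel z {x} \<gamma> - cbel z UNIV \<gamma>)) +
     (\<Sum>\<gamma>\<in>focal_sets. mass belC \<gamma> *
        (belB (\<not> x) * cbel z {\<not> x} \<gamma> + (1 - belB (\<not> x)) * cbel z UNIV \<gamma>))"
  unfolding belD_def sum_focal_sets[of _ x]
  by (simp add: mass_singleton mass_UNIV[of _ x] algebra_simps)

lemma has_field_derivative_belD:
  "((\<lambda>t. belD cbel (belB(x := t)) belC z) has_field_derivative
     (\<Sum>\<gamma>\<in>focal_sets. mass belC \<gamma> * (cbel z {x} \<gamma> - cbel z UNIV \<gamma>))) (at s)"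
  unfolding belD_fun_upd by (auto intro!: derivative_eq_intros)

text \<open>This and the next two lemmas invert the qualitative sum for each determinate
  result.\<close>

lemma qadd_qsign_eq_QZero_iff:
  "qsign u \<oplus>\<^sub>q qsign v \<oplus>\<^sub>q qsign w = QZero \<longleftrightarrow> u = 0 \<and> v = 0 \<and> w = 0"
  by (auto simp: qsign_def)

lemma qadd_qsign_eq_QPos_iff:
  "qsign u \<oplus>\<^sub>q qsign v \<oplus>\<^sub>q qsign w = QPos \<longleftrightarrow>
     u \<ge> 0 \<and> v \<ge> 0 \<and> w \<ge> 0 \<and> (u \<noteq> 0 \<or> v \<noteq> 0 \<or> w \<noteq> 0)"
  by (auto simp: qsign_def)

lemma qadd_qsign_eq_QNeg_iff:
  "qsign u \<oplus>\<^sub>q qsign v \<oplus>\<^sub>q qsign w = QNeg \<longleftrightarrow>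
     u \<le> 0 \<and> v \<le> 0 \<and> w \<le> 0 \<and> (u \<noteq> 0 \<or> v \<noteq> 0 \<or> w \<noteq> 0)"
  by (auto simp: qsign_def)

lemma sum_weighted_pos:
  fixes m u :: "'a \<Rightarrow> real"
  assumes "finite S" "\<And>i. i \<in> S \<Longrightarrow> m i \<ge> 0" "\<And>i. i \<in> S \<Longrightarrow> u i \<ge> 0"
    and "\<exists>i\<in>S. u i \<noteq> 0 \<and> m i > 0"
  shows "(\<Sum>i\<in>S. m i * u i) > 0"
proof -
  obtain i where "i \<in> S" "u i \<noteq> 0" "m i > 0"
    using assms(4) by blast
  moreover from this have "u i > 0"
    using assms(3)[of i] by linarith
  ultimately show ?thesis
    using assms(1-3) by (intro sum_pos2[of _ i]) auto
qed

lemma qsign_weighted_sum: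
  fixes m u :: "bool set \<Rightarrow> real"
  assumes nonneg: "\<And>\<gamma>. m \<gamma> \<ge> 0"
    and witness: "(\<exists>\<gamma>\<in>focal_sets. u \<gamma> \<noteq> 0) \<Longrightarrow> \<exists>\<gamma>\<in>focal_sets. u \<gamma> \<noteq> 0 \<and> m \<gamma> > 0"
  shows "qsign (\<Sum>\<gamma>\<in>focal_sets. m \<gamma> * u \<gamma>) =\<^sub>q
           qsign (u {y}) \<oplus>\<^sub>q qsign (u {\<not> y}) \<oplus>\<^sub>q qsign (u UNIV)"
    (is "qsign ?S =\<^sub>q ?q")
proof (cases ?q)
  case QPos
  then have "?S > 0"
    using nonneg witness
    by (intro sum_weighted_pos) (auto simp: qadd_qsign_eq_QPos_iff focal_sets_eq[of y])
  with QPos show ?thesis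
    by (simp add: qeq_def qsign_def)
next
  case QZero
  then have "?S = 0"
    by (auto simp: qadd_qsign_eq_QZero_iff sum_focal_sets[of _ y])
  with QZero show ?thesis
    by (simp add: qeq_def qsign_def)
next
  case QNeg
  \<comment> \<open>Negating \<open>u\<close> reduces this case to the positive one.\<close>
  then have "(\<Sum>\<gamma>\<in>focal_sets. m \<gamma> * - u \<gamma>) > 0"
    using nonneg witness
    by (intro sum_weighted_pos) (auto simp: qadd_qsign_eq_QNeg_iff focal_sets_eq[of y])
  then have "?S < 0"
    by (simp add: sum_negf)
  with QNeg show ?thesis
    by (simp add: qeq_def qsign_def)
next
  case QAny
  then show ?thesis
    by (simp add: qeq_def)
qed

text \<open>\<open>nondegenerate\<close> excludes a zero slope caused by zero weights: if
  \<open>belC\<close> puts all mass on \<open>UNIV\<close> and the differences vanish except a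
  positive one at \<open>{y}\<close>, the derivative is 0 but the sum is [+]. Differentiability is
  asserted since \<open>deriv\<close> is an arbitrary value where no derivative exists.\<close>

theorem theorem5p3:
  fixes cbel :: "bool \<Rightarrow> bool set \<Rightarrow> bool set \<Rightarrow> real"
    and belB belC :: "bool \<Rightarrow> real"
    and x y z :: bool
  assumes cond: "\<And>w \<beta> \<gamma>. \<beta> \<in> focal_sets \<Longrightarrow> \<gamma> \<in> focal_sets \<Longrightarrow> cbel w \<beta> \<gamma> \<in> {0..1}"
    and B: "belief_pair belB"
    and C: "belief_pair belC"
    and nondegenerate:
      "(\<exists>\<gamma>\<in>focal_sets. cbel z {x} \<gamma> \<noteq> cbel z UNIV \<gamma>) \<longrightarrow>
       (\<exists>\<gamma>\<in>focal_sets. cbel z {x} \<gamma> \<noteq> cbel z UNIV \<gamma> \<and> mass belC \<gamma> > 0)"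
  shows "(\<lambda>t. belD cbel (belB(x := t)) belC z) field_differentiable (at (belB x)) \<and>
         qsign (deriv (\<lambda>t. belD cbel (belB(x := t)) belC z) (belB x)) =\<^sub>q
           qsign (cbel z {x} {y} - cbel z UNIV {y})
           \<oplus>\<^sub>q qsign (cbel z {x} {\<not> y} - cbel z UNIV {\<not> y})
           \<oplus>\<^sub>q qsign (cbel z {x} UNIV - cbel z UNIV UNIV)"
proof
  show "(\<lambda>t. belD cbel (belB(x := t)) belC z) field_differentiable (at (belB x))"
    using has_field_derivative_belD field_differentiable_def by blast
  show "qsign (deriv (\<lambda>t. belD cbel (belB(x := t)) belC z) (belB x)) =\<^sub>q
          qsign (cbel z {x} {y} - cbel z UNIV {y})
          \<oplus>\<^sub>q qsign (cbel z {x} {\<not> y} - cbel z UNIV {\<not> y})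
          \<oplus>\<^sub>q qsign (cbel z {x} UNIV - cbel z UNIV UNIV)"
    unfolding DERIV_imp_deriv[OF has_field_derivative_belD]
    \<comment> \<open>With the masses of \<open>belC\<close> as weights,
      \<open>nondegenerate\<close> is the premise \<open>witness\<close>.\<close>
    using nondegenerate
    by (intro qsign_weighted_sum[where u = "\<lambda>\<gamma>. cbel z {x} \<gamma> - cbel z UNIV \<gamma>"] mass_nonneg[OF C])
       auto
qed

end
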